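(* Let $R$ be a ring and $a\in R$. Then the following are equivalent: (1) $a$ has generalized Zhou inverse. (2) There exists $p^2=p\in comm^2(a)$ such that $a^n-p\in\sqrt{J(R)}$ for some $n\in\mathbb{N}$. (3) There exists $x\in comm^2(a)$ such that $x=xax$ and $a-a^{n+2}x\in\sqrt{J(R)}$ for some $n\in\mathbb{N}$.
   Context: All rings are associative with identity $1$ (not necessarily commutative). $\mathbb{N}$ denotes the positive integers. $J(R)$ is the Jacobson radical of $R$ and $\sqrt{J(R)}=\{x\in R : x^m\in J(R)\text{ for some } m\in\mathbb{N}\}$. For $a\in R$, $comm(a)=\{x\in R: xa=ax\}$ and $comm^2(a)=\{x\in R: xy=yx\text{ for all }y\in comm(a)\}$. An element $a\in R$ has generalized Zhou inverse if there exists $b\in R$ such that $b=bab$, $b\in comm^2(a)$ and $a^n-ab\in\sqrt{J(R)}$ for some $n\in\mathbb{N}$. *)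

theory Defs
  imports "HOL-Algebra.Ideal"
begin

text \<open>
  Rings are those of the locale \<^locale>\<open>ring\<close>: associative with identity, not necessarily
  commutative, and possibly the zero ring. The locales \<^locale>\<open>ideal\<close> and
  \<^locale>\<open>maximalideal\<close> describe two-sided ideals, which do not give the Jacobson radical of a
  noncommutative ring, hence the one-sided versions below.
\<close>

locale left_ideal = additive_subgroup I R + ring R for I and R (structure) +
  assumes I_l_closed: "\<lbrakk>a \<in> I; x \<in> carrier R\<rbrakk> \<Longrightarrow> x \<otimes> a \<in> I"

locale maximal_left_ideal = left_ideal M R for M and R (structure) +
  assumes I_notcarr: "carrier R \<noteq> M"
    and I_maximal: "\<lbrakk>left_ideal J R; M \<subseteq> J; J \<subseteq> carrier R\<rbrakk> \<Longrightarrow> J = M \<or> J = carrier R"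

text \<open>
  The intersection of all maximal left ideals. Intersecting with the carrier only matters for the
  zero ring, which has no maximal left ideal and is its own radical.
\<close>

definition jacobson_radical :: "('a, 'b) ring_scheme \<Rightarrow> 'a set"
  where "jacobson_radical R = carrier R \<inter> \<Inter>{M. maximal_left_ideal M R}"

definition sqrt_jacobson :: "('a, 'b) ring_scheme \<Rightarrow> 'a set"
  where "sqrt_jacobson R =
    {x \<in> carrier R. \<exists>m::nat. m \<ge> 1 \<and> x [^]\<^bsub>R\<^esub> m \<in> jacobson_radical R}"

definition comm :: "('a, 'b) ring_scheme \<Rightarrow> 'a \<Rightarrow> 'a set"
  where "comm R a = {x \<in> carrier R. x \<otimes>\<^bsub>R\<^esub> a = a \<otimes>\<^bsub>R\<^esub> x}"

definition comm2 :: "('a, 'b) ring_scheme \<Rightarrow> 'a \<Rightarrow> 'a set"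
  where "comm2 R a = {x \<in> carrier R. \<forall>y \<in> comm R a. x \<otimes>\<^bsub>R\<^esub> y = y \<otimes>\<^bsub>R\<^esub> x}"

definition has_generalized_Zhou_inverse :: "('a, 'b) ring_scheme \<Rightarrow> 'a \<Rightarrow> bool"
  where "has_generalized_Zhou_inverse R a \<longleftrightarrow>
    (\<exists>b \<in> carrier R. b = b \<otimes>\<^bsub>R\<^esub> a \<otimes>\<^bsub>R\<^esub> b \<and> b \<in> comm2 R a \<and>
      (\<exists>n::nat. n \<ge> 1 \<and> a [^]\<^bsub>R\<^esub> n \<ominus>\<^bsub>R\<^esub> a \<otimes>\<^bsub>R\<^esub> b \<in> sqrt_jacobson R))"

end

theory Submission
  imports Defs "HOL-Algebra.Subrings"
begin

text \<open>
  The double commutant of \<open>a\<close> is a commutative subring that contains \<open>a\<close> and the inverses of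
  its elements that are units of \<open>R\<close> (\<open>comm2_subcring\<close>, \<open>comm2_inv_closed\<close>). All elements that
  occur in the three conditions lie in it, so the proof is commutative algebra there, combined
  with three facts on \<open>\<surd>J(R)\<close>: it absorbs commuting factors (\<open>sqrt_jacobson_m_closed\<close>), it
  contains every element that has a positive power in it (\<open>sqrt_jacobson_of_pow\<close>), and \<open>1 - w\<close>
  is a unit for each of its elements \<open>w\<close> (\<open>sqrt_jacobson_one_minus_Units\<close>).

  From (1) to (2) take \<open>p = ab\<close>. For the converse put \<open>w = a\<^sup>n - p\<close>. The element \<open>u = 1 + w\<close> is a
  unit and agrees with \<open>a\<^sup>n\<close> after multiplication by \<open>p\<close>, so \<open>b = a\<^sup>n\<^sup>-\<^sup>1pu\<^sup>-\<^sup>1\<close> inverts \<open>a\<close> on the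
  summand cut out by \<open>p\<close>: \<open>ab = p\<close> and \<open>bab = pb = b\<close>.

  For the equivalence of (1) and (3) the same element serves as \<open>b\<close> and as \<open>x\<close>. With \<open>p = ax\<close>,
  \<open>w = a\<^sup>n - p\<close> and \<open>c = a - a\<^sup>n\<^sup>+\<^sup>2x = a(1 - a\<^sup>np)\<close>, each of \<open>w\<close> and \<open>c\<close> is controlled by the other:
  \<open>w\<close> divides \<open>c\<^sup>n\<close>, because \<open>a\<^sup>n(1 - a\<^sup>np)\<close> vanishes when \<open>a\<^sup>n\<close> is replaced by the idempotent \<open>p\<close>
  (\<open>idempotent_factor\<close>), and \<open>c\<close> divides \<open>w\<close> (\<open>reflexive_inverse_factor\<close>). All
  factors commute, so membership in \<open>\<surd>J(R)\<close> passes from \<open>w\<close> to \<open>c\<^sup>n\<close>, hence to \<open>c\<close>, and from \<open>c\<close> to \<open>w\<close>.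
\<close>

section \<open>Maximal left ideals\<close>

context ring
begin

lemma left_idealI:
  assumes "I \<subseteq> carrier R" "\<zero> \<in> I"
    and "\<And>x y. \<lbrakk>x \<in> I; y \<in> I\<rbrakk> \<Longrightarrow> x \<oplus> y \<in> I"
    and l_closed: "\<And>x r. \<lbrakk>x \<in> I; r \<in> carrier R\<rbrakk> \<Longrightarrow> r \<otimes> x \<in> I"
  shows "left_ideal I R"
proof -
  have "\<ominus> x \<in> I" if "x \<in> I" for x
  proof -
    have "\<ominus> x = (\<ominus> \<one>) \<otimes> x"
      using that assms(1) by (auto simp: l_minus)
    then show ?thesis
      using l_closed[OF that, of "\<ominus> \<one>"] by simp
  qed
  then have "subgroup I (add_monoid R)"
    using assms by (intro add.subgroupI) (auto simp: a_inv_def)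
  then show ?thesis
    using l_closed
    by (simp add: left_ideal_def left_ideal_axioms_def additive_subgroup_def ring_axioms)
qed

lemma left_idealD:
  assumes "left_ideal I R"
  shows "I \<subseteq> carrier R" "\<zero> \<in> I"
    and "\<And>x y. \<lbrakk>x \<in> I; y \<in> I\<rbrakk> \<Longrightarrow> x \<oplus> y \<in> I"
    and "\<And>x r. \<lbrakk>x \<in> I; r \<in> carrier R\<rbrakk> \<Longrightarrow> r \<otimes> x \<in> I"
proof -
  interpret left_ideal I R by fact
  show "I \<subseteq> carrier R" "\<zero> \<in> I"
    and "\<And>x y. \<lbrakk>x \<in> I; y \<in> I\<rbrakk> \<Longrightarrow> x \<oplus> y \<in> I"
    and "\<And>x r. \<lbrakk>x \<in> I; r \<in> carrier R\<rbrakk> \<Longrightarrow> r \<otimes> x \<in> I"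
    using a_subset I_l_closed by auto
qed

lemma left_ideal_one_imp_carrier:
  assumes "left_ideal I R" "\<one> \<in> I"
  shows "I = carrier R"
  using left_idealD(1,4)[OF assms(1)] assms(2) by (metis r_one subsetI subset_antisym)

lemma left_ideal_principal:
  assumes "x \<in> carrier R"
  shows "left_ideal ((\<lambda>r. r \<otimes> x) ` carrier R) R"
proof (rule left_idealI)
  show "\<zero> \<in> (\<lambda>r. r \<otimes> x) ` carrier R"
    using assms by (intro image_eqI[of _ _ \<zero>]) auto
  show "y \<oplus> z \<in> (\<lambda>r. r \<otimes> x) ` carrier R"
    if "y \<in> (\<lambda>r. r \<otimes> x) ` carrier R" "z \<in> (\<lambda>r. r \<otimes> x) ` carrier R" for y z
    using that assms by (auto simp flip: l_distr)
  show "r \<otimes> y \<in> (\<lambda>r. r \<otimes> x) ` carrier R"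
    if "y \<in> (\<lambda>r. r \<otimes> x) ` carrier R" "r \<in> carrier R" for y r
    using that assms by (auto simp flip: m_assoc)
qed (use assms in auto)

lemma left_ideal_chain_Union:
  assumes "\<C> \<noteq> {}" and left: "\<And>I. I \<in> \<C> \<Longrightarrow> left_ideal I R"
    and chain: "\<And>I J. \<lbrakk>I \<in> \<C>; J \<in> \<C>\<rbrakk> \<Longrightarrow> I \<subseteq> J \<or> J \<subseteq> I"
  shows "left_ideal (\<Union>\<C>) R"
proof (rule left_idealI)
  show "x \<oplus> y \<in> \<Union>\<C>" if "x \<in> \<Union>\<C>" "y \<in> \<Union>\<C>" for x y
  proof -
    obtain I J where IJ: "I \<in> \<C>" "x \<in> I" "J \<in> \<C>" "y \<in> J"
      using \<open>x \<in> \<Union>\<C>\<close> \<open>y \<in> \<Union>\<C>\<close> by (elim UnionE)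
    from chain[OF IJ(1,3)] show ?thesis
    proof
      assume "I \<subseteq> J"
      then have "x \<oplus> y \<in> J" using IJ left_idealD(3)[OF left] by (simp add: subset_iff)
      then show ?thesis using IJ(3) by (rule UnionI[rotated])
    next
      assume "J \<subseteq> I"
      then have "x \<oplus> y \<in> I" using IJ left_idealD(3)[OF left] by (simp add: subset_iff)
      then show ?thesis using IJ(1) by (rule UnionI[rotated])
    qed
  qed
  show "\<Union>\<C> \<subseteq> carrier R" using left_idealD(1)[OF left] by (rule Union_least)
  show "\<zero> \<in> \<Union>\<C>" using assms(1) left_idealD(2)[OF left] by auto
  show "r \<otimes> x \<in> \<Union>\<C>" if "x \<in> \<Union>\<C>" "r \<in> carrier R" for x r
    using that left_idealD(4)[OF left] by auto
qed

text \<open>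
  Zorn's lemma, applied to the left ideals above \<open>I\<close> that avoid \<open>1\<close>: this property, unlike
  properness stated as \<open>J \<noteq> R\<close>, visibly passes to unions of chains.
\<close>

lemma exists_maximal_left_ideal:
  assumes "left_ideal I R" "\<one> \<notin> I"
  shows "\<exists>M. maximal_left_ideal M R \<and> I \<subseteq> M"
proof -
  let ?A = "{J. left_ideal J R \<and> I \<subseteq> J \<and> \<one> \<notin> J}"
  have "\<exists>M\<in>?A. \<forall>X\<in>?A. M \<subseteq> X \<longrightarrow> X = M"
  proof (rule subset_Zorn_nonempty)
    show "?A \<noteq> {}" using assms by blast
    show "\<Union>\<C> \<in> ?A" if "\<C> \<noteq> {}" "subset.chain ?A \<C>" for \<C>
    proof -
      have sub: "\<C> \<subseteq> ?A" and chain: "\<And>I J. \<lbrakk>I \<in> \<C>; J \<in> \<C>\<rbrakk> \<Longrightarrow> I \<subseteq> J \<or> J \<subseteq> I"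
        using that(2) by (auto simp: subset_chain_def)
      have "left_ideal (\<Union>\<C>) R"
        using that(1) sub chain by (intro left_ideal_chain_Union) auto
      then show ?thesis using sub that(1) by auto
    qed
  qed
  then obtain M where M_in: "M \<in> ?A" and M_max: "\<forall>X\<in>?A. M \<subseteq> X \<longrightarrow> X = M" ..
  have M: "left_ideal M R" "I \<subseteq> M" "\<one> \<notin> M"
    using M_in by simp_all
  have max: "X = M" if "left_ideal X R" "\<one> \<notin> X" "M \<subseteq> X" for X
    using that M(2) M_max by (metis (mono_tags, lifting) CollectI subset_trans)
  have "maximal_left_ideal M R"
  proof (intro maximal_left_ideal.intro maximal_left_ideal_axioms.intro M(1))
    show "carrier R \<noteq> M" using M(3) by auto
    show "J = M \<or> J = carrier R" if "left_ideal J R" "M \<subseteq> J" for J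
      using max[OF that(1) _ that(2)] left_ideal_one_imp_carrier[OF that(1)] by argo
  qed
  then show ?thesis using M(2) by blast
qed

section \<open>The Jacobson radical and its square root\<close>

lemma jacobson_radical_subset: "jacobson_radical R \<subseteq> carrier R"
  by (auto simp: jacobson_radical_def)

lemma jacobson_radical_l_closed:
  assumes "x \<in> jacobson_radical R" "r \<in> carrier R"
  shows "r \<otimes> x \<in> jacobson_radical R"
  using assms left_idealD(4)[OF maximal_left_ideal.axioms(1)]
  by (auto simp: jacobson_radical_def)

text \<open>
  If the left ideal generated by \<open>1 - x\<close> were proper, a maximal left ideal above it would contain
  \<open>1 - x\<close> and, by definition of the radical, also \<open>x\<close>, hence \<open>1\<close>.
\<close>

lemma jacobson_radical_one_minus_l_inv:
  assumes "x \<in> jacobson_radical R"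
  obtains l where "l \<in> carrier R" "l \<otimes> (\<one> \<ominus> x) = \<one>"
proof -
  have x: "x \<in> carrier R" using assms jacobson_radical_subset by blast
  let ?I = "(\<lambda>r. r \<otimes> (\<one> \<ominus> x)) ` carrier R"
  have I: "left_ideal ?I R" using x by (intro left_ideal_principal) simp
  have "\<one> \<in> ?I"
  proof (rule ccontr)
    assume "\<one> \<notin> ?I"
    then obtain M where max: "maximal_left_ideal M R" and sub: "?I \<subseteq> M"
      using exists_maximal_left_ideal I by blast
    have M: "left_ideal M R" using max by (rule maximal_left_ideal.axioms(1))
    have "\<one> \<ominus> x \<in> ?I" using x by (intro image_eqI[of _ _ \<one>]) auto
    moreover have "x \<in> M" using assms max by (auto simp: jacobson_radical_def)
    ultimately have "(\<one> \<ominus> x) \<oplus> x \<in> M" using sub left_idealD(3)[OF M] by blast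
    moreover have "(\<one> \<ominus> x) \<oplus> x = \<one>" using x by (simp add: minus_eq a_assoc l_neg)
    ultimately have "M = carrier R" using left_ideal_one_imp_carrier M by simp
    then show False using maximal_left_ideal.I_notcarr[OF max] by simp
  qed
  then obtain l where "l \<in> carrier R" "\<one> = l \<otimes> (\<one> \<ominus> x)" by (elim imageE)
  then show ?thesis using that by simp
qed

text \<open>
  A left inverse \<open>l\<close> of \<open>1 - x\<close> equals \<open>1 + lx\<close>. Since \<open>-lx\<close> is again in the radical, \<open>l\<close> has a
  left inverse too, and an element with inverses on both sides is a unit.
\<close>

lemma jacobson_radical_one_minus_Units:
  assumes "x \<in> jacobson_radical R"
  shows "\<one> \<ominus> x \<in> Units R"
proof -
  have x: "x \<in> carrier R" using assms jacobson_radical_subset by blast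
  obtain l where l: "l \<in> carrier R" "l \<otimes> (\<one> \<ominus> x) = \<one>"
    using jacobson_radical_one_minus_l_inv[OF assms] .
  have "(\<ominus> l) \<otimes> x \<in> jacobson_radical R"
    using assms l(1) by (intro jacobson_radical_l_closed) auto
  then obtain k where k: "k \<in> carrier R" "k \<otimes> (\<one> \<ominus> (\<ominus> l) \<otimes> x) = \<one>"
    using jacobson_radical_one_minus_l_inv by blast
  have "l = l \<otimes> (\<one> \<ominus> x) \<oplus> l \<otimes> x"
    using l(1) x by (simp add: minus_eq r_distr r_minus a_assoc l_neg)
  also have "\<dots> = \<one> \<ominus> (\<ominus> l) \<otimes> x"
    using l x by (simp add: minus_eq l_minus)
  finally have kl: "k \<otimes> l = \<one>" using k(2) by simp
  have "k = k \<otimes> (l \<otimes> (\<one> \<ominus> x))" using k(1) l(2) by simp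
  also have "\<dots> = \<one> \<ominus> x" using k(1) l(1) x kl by (simp flip: m_assoc)
  finally have "(\<one> \<ominus> x) \<otimes> l = \<one>" using kl by simp
  then show ?thesis using l x unfolding Units_def by blast
qed

text \<open>
  The witness is the geometric sum \<open>1 + x + \<dots> + x\<^sup>m\<^sup>-\<^sup>1\<close>. Both sides are recorded, so that a unit
  \<open>1 - x\<^sup>m\<close> yields a left and a right inverse of \<open>1 - x\<close> in a noncommutative ring.
\<close>

lemma one_minus_pow_factor:
  assumes x: "x \<in> carrier R"
  shows "\<exists>s\<in>carrier R. s \<otimes> (\<one> \<ominus> x) = \<one> \<ominus> x [^] (m::nat) \<and> (\<one> \<ominus> x) \<otimes> s = \<one> \<ominus> x [^] m"
proof (induction m)
  case 0
  then show ?case using x by (intro bexI[of _ \<zero>]) (auto simp: minus_eq r_neg)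
next
  case (Suc m)
  then obtain s where s: "s \<in> carrier R" "s \<otimes> (\<one> \<ominus> x) = \<one> \<ominus> x [^] m"
      "(\<one> \<ominus> x) \<otimes> s = \<one> \<ominus> x [^] m" by blast
  \<comment> \<open>Adding \<open>x\<^sup>m\<close> to the geometric sum changes the product by this telescoping term.\<close>
  have tele: "\<one> \<ominus> x [^] m \<oplus> (x [^] m \<ominus> x [^] Suc m) = \<one> \<ominus> x [^] Suc m"
    using x by (simp add: minus_eq a_assoc r_neg1 del: nat_pow_Suc)
  have "(s \<oplus> x [^] m) \<otimes> (\<one> \<ominus> x) = s \<otimes> (\<one> \<ominus> x) \<oplus> x [^] m \<otimes> (\<one> \<ominus> x)"
    using s(1) x by (simp add: l_distr)
  also have "x [^] m \<otimes> (\<one> \<ominus> x) = x [^] m \<ominus> x [^] Suc m"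
    using x by (simp add: minus_eq r_distr r_minus)
  finally have left: "(s \<oplus> x [^] m) \<otimes> (\<one> \<ominus> x) = \<one> \<ominus> x [^] Suc m"
    unfolding s(2) tele .
  have "(\<one> \<ominus> x) \<otimes> (s \<oplus> x [^] m) = (\<one> \<ominus> x) \<otimes> s \<oplus> (\<one> \<ominus> x) \<otimes> x [^] m"
    using s(1) x by (simp add: r_distr)
  also have "(\<one> \<ominus> x) \<otimes> x [^] m = x [^] m \<ominus> x [^] Suc m"
    using x nat_pow_Suc2[OF x, of m] by (simp add: minus_eq l_distr l_minus)
  finally have "(\<one> \<ominus> x) \<otimes> (s \<oplus> x [^] m) = \<one> \<ominus> x [^] Suc m"
    unfolding s(3) tele .
  then show ?case using left s(1) x by (intro bexI[of _ "s \<oplus> x [^] m"]) auto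
qed

lemma sqrt_jacobson_one_minus_Units:
  assumes "x \<in> sqrt_jacobson R"
  shows "\<one> \<ominus> x \<in> Units R"
proof -
  obtain m :: nat where x: "x \<in> carrier R" and m: "x [^] m \<in> jacobson_radical R"
    using assms by (auto simp: sqrt_jacobson_def)
  let ?v = "inv (\<one> \<ominus> x [^] m)"
  have U: "\<one> \<ominus> x [^] m \<in> Units R" using m by (rule jacobson_radical_one_minus_Units)
  obtain s where s: "s \<in> carrier R" "s \<otimes> (\<one> \<ominus> x) = \<one> \<ominus> x [^] m"
      "(\<one> \<ominus> x) \<otimes> s = \<one> \<ominus> x [^] m"
    using one_minus_pow_factor[OF x] by blast
  have left: "(?v \<otimes> s) \<otimes> (\<one> \<ominus> x) = \<one>" using U s x by (simp add: m_assoc)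
  have right: "(\<one> \<ominus> x) \<otimes> (s \<otimes> ?v) = \<one>" using U s x by (simp flip: m_assoc)
  have "?v \<otimes> s = s \<otimes> ?v"
    using U s(1) x by (intro inv_unique[OF left right]) auto
  then have "(\<one> \<ominus> x) \<otimes> (?v \<otimes> s) = \<one>" using right by simp
  moreover have "?v \<otimes> s \<in> carrier R" using U s(1) by simp
  ultimately show ?thesis using left x unfolding Units_def by blast
qed

lemma sqrt_jacobson_m_closed:
  assumes "x \<in> sqrt_jacobson R" "r \<in> carrier R" "x \<otimes> r = r \<otimes> x"
  shows "x \<otimes> r \<in> sqrt_jacobson R"
proof -
  obtain m :: nat where x: "x \<in> carrier R" and m: "m \<ge> 1" "x [^] m \<in> jacobson_radical R"
    using assms by (auto simp: sqrt_jacobson_def)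
  have "(x \<otimes> r) [^] m = r [^] m \<otimes> x [^] m"
    using assms(2,3) x by (simp add: pow_mult_distrib)
  then have "(x \<otimes> r) [^] m \<in> jacobson_radical R"
    using m(2) assms(2) by (simp add: jacobson_radical_l_closed)
  then show ?thesis using x assms(2) m(1) by (auto simp: sqrt_jacobson_def)
qed

lemma sqrt_jacobson_of_pow:
  assumes "x \<in> carrier R" "(n::nat) \<ge> 1" "x [^] n \<in> sqrt_jacobson R"
  shows "x \<in> sqrt_jacobson R"
proof -
  obtain m :: nat where "m \<ge> 1" "(x [^] n) [^] m \<in> jacobson_radical R"
    using assms(3) by (auto simp: sqrt_jacobson_def)
  then have "n * m \<ge> 1" "x [^] (n * m) \<in> jacobson_radical R"
    using assms(1,2) by (auto simp: nat_pow_pow)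
  then have "\<exists>k::nat. k \<ge> 1 \<and> x [^] k \<in> jacobson_radical R" by blast
  then show ?thesis using assms(1) by (simp add: sqrt_jacobson_def)
qed

section \<open>The double commutant\<close>

lemma self_in_comm2: "a \<in> carrier R \<Longrightarrow> a \<in> comm2 R a"
  by (auto simp: comm2_def comm_def)

text \<open>
  Commutativity holds because \<open>a\<close> commutes with itself: elements of the double commutant commute
  with \<open>a\<close>, hence lie in its commutant, hence commute with each other.
\<close>

lemma comm2_subcring:
  assumes a: "a \<in> carrier R"
  shows "subcring (comm2 R a) R"
proof (rule subcringI[OF subringI])
  show "x \<otimes> y \<in> comm2 R a" if "x \<in> comm2 R a" "y \<in> comm2 R a" for x y
  proof -
    have "(x \<otimes> y) \<otimes> z = z \<otimes> (x \<otimes> y)" if z: "z \<in> comm R a" for z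
    proof -
      have "x \<in> carrier R" "y \<in> carrier R" "z \<in> carrier R" "x \<otimes> z = z \<otimes> x" "y \<otimes> z = z \<otimes> y"
        using z \<open>x \<in> comm2 R a\<close> \<open>y \<in> comm2 R a\<close> by (auto simp: comm2_def comm_def)
      then show ?thesis by (metis m_assoc)
    qed
    then show ?thesis using that by (auto simp: comm2_def)
  qed
  show "x \<otimes> y = y \<otimes> x" if "x \<in> comm2 R a" "y \<in> comm2 R a" for x y
  proof -
    have "a \<in> comm R a" using a by (simp add: comm_def)
    then have "y \<in> comm R a" using that(2) by (auto simp: comm_def comm2_def)
    then show ?thesis using that(1) by (auto simp: comm2_def)
  qed
qed (auto simp: comm2_def comm_def l_distr r_distr l_minus r_minus)

lemma comm2_inv_closed:
  assumes "u \<in> comm2 R a" and u: "u \<in> Units R"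
  shows "inv u \<in> comm2 R a"
proof -
  have "inv u \<otimes> y = y \<otimes> inv u" if "y \<in> comm R a" for y
  proof -
    have y: "y \<in> carrier R" and uy: "u \<otimes> y = y \<otimes> u"
      using that assms(1) by (auto simp: comm2_def comm_def)
    have "inv u \<otimes> y = inv u \<otimes> (y \<otimes> u) \<otimes> inv u" using u y by (simp add: m_assoc Units_closed)
    also have "\<dots> = inv u \<otimes> (u \<otimes> y) \<otimes> inv u" by (simp add: uy)
    also have "\<dots> = y \<otimes> inv u" using u y by (simp add: Units_closed flip: m_assoc)
    finally show ?thesis .
  qed
  then show ?thesis using u by (auto simp: comm2_def)
qed

end

section \<open>Identities with an idempotent in a commutative ring\<close>

context cring
begin

text \<open>
  The polynomial \<open>A - A\<^sup>2p\<close> in \<open>A\<close> vanishes at \<open>A = p\<close>, as \<open>p - p\<^sup>3 = 0\<close>; the right-hand side is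
  the result of dividing it by \<open>A - p\<close>.
\<close>

lemma idempotent_factor:
  assumes "A \<in> carrier R" "p \<in> carrier R" "p \<otimes> p = p"
  shows "A \<otimes> (\<one> \<ominus> A \<otimes> p) = (A \<ominus> p) \<otimes> (\<one> \<ominus> A \<otimes> p \<ominus> p)"
proof -
  have "p \<otimes> (p \<otimes> z) = p \<otimes> z" if "z \<in> carrier R" for z
    using that assms by (simp flip: m_assoc)
  then show ?thesis using assms by algebra
qed

lemma idempotent_unit_part:
  assumes "A \<in> carrier R" "p \<in> carrier R" "p \<otimes> p = p"
  shows "A \<otimes> p = (\<one> \<oplus> (A \<ominus> p)) \<otimes> p"
  using assms by algebra

text \<open>
  To be read with \<open>B = a\<^sup>n\<^sup>-\<^sup>1\<close>. Put \<open>p = ax\<close> and let \<open>c = a(1 - aBp)\<close> be the first factor on the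
  right. Multiplying \<open>c\<close> by \<open>1 - p\<close> leaves \<open>a(1 - p)\<close>, whence \<open>cB(1 - p) = aB(1 - p)\<close>, while
  \<open>cx = p - aBp\<close>. The difference of these two products is \<open>aB - p\<close>.
\<close>

lemma reflexive_inverse_factor:
  assumes a: "a \<in> carrier R" and B: "B \<in> carrier R" and x: "x \<in> carrier R"
    and refl: "x = x \<otimes> a \<otimes> x"
  shows "a \<otimes> B \<ominus> a \<otimes> x =
    (a \<ominus> a \<otimes> (a \<otimes> (a \<otimes> B)) \<otimes> x) \<otimes> (B \<otimes> (\<one> \<ominus> a \<otimes> x) \<ominus> x)"
proof -
  let ?p = "a \<otimes> x"
  let ?A = "a \<otimes> B"
  have p: "?p \<in> carrier R" using a x by simp
  have pp: "?p \<otimes> ?p = ?p"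
  proof -
    have "?p \<otimes> ?p = a \<otimes> (x \<otimes> a \<otimes> x)" using a x by (simp add: m_assoc)
    then show ?thesis using refl by simp
  qed
  have ppz: "?p \<otimes> (?p \<otimes> z) = ?p \<otimes> z" if "z \<in> carrier R" for z
    using that p pp by (simp flip: m_assoc)
  have c: "a \<ominus> a \<otimes> (a \<otimes> ?A) \<otimes> x = a \<otimes> (\<one> \<ominus> ?A \<otimes> ?p)"
    using a B x by (simp add: minus_eq r_distr r_minus m_ac)
  \<comment> \<open>Generic \<open>D\<close> and \<open>E\<close>, as below a generic \<open>q\<close>, keep the simplifier from expanding subterms
    whose structure is irrelevant to the identity.\<close>
  have "a \<otimes> D \<otimes> (B \<otimes> E \<ominus> x) = D \<otimes> (?A \<otimes> E \<ominus> ?p)"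
    if "D \<in> carrier R" "E \<in> carrier R" for D E
    using a B x that by (simp add: minus_eq r_distr r_minus m_ac)
  then have "a \<otimes> (\<one> \<ominus> ?A \<otimes> ?p) \<otimes> (B \<otimes> (\<one> \<ominus> ?p) \<ominus> x)
      = (\<one> \<ominus> ?A \<otimes> ?p) \<otimes> (?A \<otimes> (\<one> \<ominus> ?p) \<ominus> ?p)"
    using a B p by simp
  also have "\<dots> = ?A \<ominus> ?p"
  proof -
    have "(\<one> \<ominus> A \<otimes> q) \<otimes> (A \<otimes> (\<one> \<ominus> q) \<ominus> q) = A \<ominus> q"
      if "A \<in> carrier R" "q \<in> carrier R" "q \<otimes> q = q"
        "\<And>z. z \<in> carrier R \<Longrightarrow> q \<otimes> (q \<otimes> z) = q \<otimes> z" for A q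
      using that by (algebra, simp)
    then show ?thesis using a B p pp ppz by simp
  qed
  finally show ?thesis using c by simp
qed

end

section \<open>The three conditions\<close>

context ring
begin

lemma comm2_cring:
  assumes "a \<in> carrier R"
  shows "cring (R\<lparr>carrier := comm2 R a\<rparr>)"
  using comm2_subcring[OF assms] subcring_iff subcringE(1) by blast

text \<open>
  Negation is defined from the carrier, so the difference in a subring has to be identified with
  the difference in \<open>R\<close> before the identities for commutative rings can be used in \<open>R\<close>.
\<close>

lemma subring_minus_consistent:
  assumes "subring H R" "x \<in> H" "y \<in> H"
  shows "x \<ominus>\<^bsub>R\<lparr>carrier := H\<rparr>\<^esub> y = x \<ominus> y"
  using add.m_inv_consistent[OF subring.axioms(1)[OF assms(1)] assms(3)]
  by (simp add: a_minus_def a_inv_def)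

lemma subring_minus_closed:
  assumes "subring H R" "x \<in> H" "y \<in> H"
  shows "x \<ominus> y \<in> H"
  using subringE(5,7)[OF assms(1)] assms(2,3) by (simp add: minus_eq)

lemma subring_pow_closed:
  assumes "subring H R" "x \<in> H"
  shows "x [^] (k::nat) \<in> H"
  by (induction k) (use subringE(3,6)[OF assms(1)] assms(2) in auto)

lemma comm2_sqrt_jacobson_m_closed:
  assumes a: "a \<in> carrier R"
    and "w \<in> comm2 R a" "y \<in> comm2 R a" "w \<in> sqrt_jacobson R"
  shows "w \<otimes> y \<in> sqrt_jacobson R"
  using sqrt_jacobson_m_closed[of w y] subcringE(1,8)[OF comm2_subcring[OF a]] assms by blast

lemma reflexive_inverse_idempotent:
  assumes a: "a \<in> carrier R" and b: "b \<in> comm2 R a" "b = b \<otimes> a \<otimes> b"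
  shows "a \<otimes> b \<in> comm2 R a" "(a \<otimes> b) \<otimes> (a \<otimes> b) = a \<otimes> b"
proof -
  have bc: "b \<in> carrier R" using b(1) by (simp add: comm2_def)
  show "a \<otimes> b \<in> comm2 R a"
    using subcringE(6)[OF comm2_subcring[OF a]] self_in_comm2[OF a] b(1) by blast
  have "(a \<otimes> b) \<otimes> (a \<otimes> b) = a \<otimes> (b \<otimes> a \<otimes> b)" using a bc by (simp add: m_assoc)
  then show "(a \<otimes> b) \<otimes> (a \<otimes> b) = a \<otimes> b" using b(2) by simp
qed

text \<open>
  Here \<open>u = 1 + (a\<^sup>n - p)\<close> is a unit with \<open>a\<^sup>np = up\<close>, and \<open>b = a\<^sup>n\<^sup>-\<^sup>1pu\<^sup>-\<^sup>1\<close> satisfies \<open>ab = p\<close>.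
\<close>

lemma idempotent_imp_Zhou:
  assumes a: "a \<in> carrier R" and p: "p \<in> comm2 R a" "p \<otimes> p = p"
    and n: "n \<ge> 1" and w: "a [^] (n::nat) \<ominus> p \<in> sqrt_jacobson R"
  shows "has_generalized_Zhou_inverse R a"
proof -
  let ?C = "comm2 R a"
  interpret S: cring "R\<lparr>carrier := ?C\<rparr>" using comm2_cring[OF a] .
  note C = comm2_subcring[OF a]
  note sub = subcring.axioms(1)[OF C]
  note minus = subring_minus_consistent[OF sub] subring_minus_closed[OF sub]
  note aC = self_in_comm2[OF a] and oneC = subcringE(3)[OF C]
    and mC = subcringE(6)[OF C] and powC = subring_pow_closed[OF sub]
  note car = subsetD[OF subcringE(1)[OF C]]
  note comm = subcringE(8)[OF C]
  obtain m where m: "n = Suc m" using n by (cases n) auto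
  let ?w = "a [^] n \<ominus> p"
  let ?u = "\<one> \<oplus> ?w"
  have wC: "?w \<in> ?C" using powC[OF aC] p(1) by (rule minus(2))
  have uC: "?u \<in> ?C" using subcringE(3,7)[OF C] wC by blast
  \<comment> \<open>\<open>1 + w\<close> is \<open>1 - (-w)\<close>, and \<open>-w = w \<cdot> (-1)\<close> stays in \<open>\<surd>J(R)\<close>.\<close>
  have "?w \<otimes> (\<ominus> \<one>) \<in> sqrt_jacobson R"
    using comm2_sqrt_jacobson_m_closed[OF a wC _ w] subcringE(3,5)[OF C] by blast
  then have "\<one> \<ominus> ?w \<otimes> (\<ominus> \<one>) \<in> Units R" by (rule sqrt_jacobson_one_minus_Units)
  moreover have "\<one> \<ominus> ?w \<otimes> (\<ominus> \<one>) = ?u"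
    using car[OF wC] by (simp add: minus_eq[of \<one>] r_minus)
  ultimately have U: "?u \<in> Units R" by simp
  let ?v = "inv ?u"
  have vC: "?v \<in> ?C" using uC U by (rule comm2_inv_closed)
  have up: "a [^] n \<otimes> p = ?u \<otimes> p"
    using S.idempotent_unit_part[of "a [^] n" p] powC[OF aC] p minus(1) by simp
  let ?b = "a [^] m \<otimes> p \<otimes> ?v"
  have bC: "?b \<in> ?C" using powC[OF aC] p(1) vC by (intro mC)
  have ab: "a \<otimes> ?b = p"
  proof -
    have "a \<otimes> ?b = a [^] n \<otimes> p \<otimes> ?v"
      using a car[OF p(1)] car[OF vC] nat_pow_Suc2[OF a, of m]
      by (simp add: m_assoc m del: nat_pow_Suc)
    also have "\<dots> = p \<otimes> ?u \<otimes> ?v" using up comm[OF uC p(1)] by simp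
    also have "\<dots> = p" using U car[OF p(1)] by (simp add: m_assoc Units_closed)
    finally show ?thesis .
  qed
  have "?b \<otimes> a \<otimes> ?b = p \<otimes> ?b"
    using ab comm[OF bC aC] by simp
  also have "\<dots> = ?b"
  proof -
    have "?b = p \<otimes> (a [^] m \<otimes> ?v)"
      using car[OF p(1)] car[OF vC] a comm[OF p(1) powC[OF aC, of m]] by (simp flip: m_assoc)
    moreover have "p \<otimes> (p \<otimes> (a [^] m \<otimes> ?v)) = (p \<otimes> p) \<otimes> (a [^] m \<otimes> ?v)"
      using car[OF p(1)] car[OF vC] a by (simp only: m_assoc m_closed nat_pow_closed)
    ultimately show ?thesis using p(2) by simp
  qed
  finally have "?b = ?b \<otimes> a \<otimes> ?b" ..
  then show ?thesis
    unfolding has_generalized_Zhou_inverse_def using car[OF bC] bC n w ab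
    by (intro bexI[of _ ?b]) auto
qed

text \<open>
  Write \<open>d = 1 - a\<^sup>np\<close> with \<open>p = ab\<close>. Then \<open>a - a\<^sup>n\<^sup>+\<^sup>2b = ad\<close>, and its power
  \<open>(ad)\<^sup>n = (a\<^sup>nd)d\<^sup>n\<^sup>-\<^sup>1\<close> is a multiple of \<open>a\<^sup>n - p\<close>.
\<close>

lemma defect_in_sqrt_jacobson:
  assumes a: "a \<in> carrier R" and b: "b \<in> comm2 R a" "b = b \<otimes> a \<otimes> b"
    and n: "n \<ge> 1" and w: "a [^] (n::nat) \<ominus> a \<otimes> b \<in> sqrt_jacobson R"
  shows "a \<ominus> a [^] (n + 2) \<otimes> b \<in> sqrt_jacobson R"
proof -
  let ?C = "comm2 R a"
  interpret S: cring "R\<lparr>carrier := ?C\<rparr>" using comm2_cring[OF a] .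
  note C = comm2_subcring[OF a]
  note sub = subcring.axioms(1)[OF C]
  note minus = subring_minus_consistent[OF sub] subring_minus_closed[OF sub]
  note aC = self_in_comm2[OF a] and oneC = subcringE(3)[OF C]
    and mC = subcringE(6)[OF C] and powC = subring_pow_closed[OF sub]
  note car = subsetD[OF subcringE(1)[OF C]]
  obtain m where m: "n = Suc m" using n by (cases n) auto
  let ?A = "a [^] n"
  let ?p = "a \<otimes> b"
  let ?d = "\<one> \<ominus> ?A \<otimes> ?p"
  note p = reflexive_inverse_idempotent[OF a b]
  have AC: "?A \<in> ?C" using aC by (rule powC)
  have dC: "?d \<in> ?C" using minus(2)[OF oneC mC[OF AC p(1)]] .
  have wC: "?A \<ominus> ?p \<in> ?C" using AC p(1) by (rule minus(2))
  have eC: "?d \<ominus> ?p \<in> ?C" using dC p(1) by (rule minus(2))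
  have "a [^] (n + 2) = a \<otimes> (?A \<otimes> a)"
    using nat_pow_Suc2[OF a, of "Suc n"] by simp
  then have c: "a \<ominus> a [^] (n + 2) \<otimes> b = a \<otimes> ?d"
    using a car[OF b(1)] by (simp add: minus_eq r_distr r_minus m_assoc)
  have "(a \<otimes> ?d) [^] n = ?A \<otimes> ?d [^] n"
    using subcringE(8)[OF C aC dC] a car[OF dC] by (rule pow_mult_distrib)
  also have "?d [^] n = ?d \<otimes> ?d [^] m"
    using nat_pow_Suc2[OF car[OF dC], of m] by (simp only: m)
  also have "?A \<otimes> (?d \<otimes> ?d [^] m) = (?A \<otimes> ?d) \<otimes> ?d [^] m"
    using a car[OF dC] by (simp add: m_assoc)
  also have "?A \<otimes> ?d = (?A \<ominus> ?p) \<otimes> (?d \<ominus> ?p)"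
    using S.idempotent_factor[of ?A ?p] AC p mC oneC dC minus by simp
  also have "\<dots> \<otimes> ?d [^] m = (?A \<ominus> ?p) \<otimes> ((?d \<ominus> ?p) \<otimes> ?d [^] m)"
    using car[OF wC] car[OF eC] car[OF dC] by (simp add: m_assoc)
  also have "\<dots> \<in> sqrt_jacobson R"
    using mC[OF eC powC[OF dC]] by (rule comm2_sqrt_jacobson_m_closed[OF a wC _ w])
  finally have "(a \<otimes> ?d) [^] n \<in> sqrt_jacobson R" .
  then show ?thesis
    unfolding c using sqrt_jacobson_of_pow[OF m_closed[OF a car[OF dC]] n] by blast
qed

lemma power_minus_idempotent_in_sqrt_jacobson:
  assumes a: "a \<in> carrier R" and x: "x \<in> comm2 R a" "x = x \<otimes> a \<otimes> x"
    and n: "n \<ge> 1" and c: "a \<ominus> a [^] (n + 2) \<otimes> x \<in> sqrt_jacobson R"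
  shows "a [^] (n::nat) \<ominus> a \<otimes> x \<in> sqrt_jacobson R"
proof -
  let ?C = "comm2 R a"
  interpret S: cring "R\<lparr>carrier := ?C\<rparr>" using comm2_cring[OF a] .
  note C = comm2_subcring[OF a]
  note sub = subcring.axioms(1)[OF C]
  note minus = subring_minus_consistent[OF sub] subring_minus_closed[OF sub]
  note aC = self_in_comm2[OF a] and oneC = subcringE(3)[OF C]
    and mC = subcringE(6)[OF C] and powC = subring_pow_closed[OF sub]
  obtain m where m: "n = Suc m" using n by (cases n) auto
  let ?c = "a \<ominus> a [^] (n + 2) \<otimes> x"
  let ?y = "a [^] m \<otimes> (\<one> \<ominus> a \<otimes> x) \<ominus> x"
  have "a [^] (n + 2) = a \<otimes> (a \<otimes> a [^] n)"
    using nat_pow_Suc2[OF a, of "Suc n"] nat_pow_Suc2[OF a, of n] by simp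
  moreover have "a [^] n = a \<otimes> a [^] m" unfolding m using a by (rule nat_pow_Suc2)
  ultimately have pow: "a [^] n = a \<otimes> a [^] m" "a [^] (n + 2) = a \<otimes> (a \<otimes> (a \<otimes> a [^] m))"
    by simp_all
  have "a [^] n \<ominus> a \<otimes> x = ?c \<otimes> ?y"
  proof -
    have "x = x \<otimes>\<^bsub>R\<lparr>carrier := ?C\<rparr>\<^esub> a \<otimes>\<^bsub>R\<lparr>carrier := ?C\<rparr>\<^esub> x"
      by (simp flip: x(2))
    from S.reflexive_inverse_factor[OF _ _ _ this, of "a [^] m"] show ?thesis
      using aC powC[OF aC] x(1) mC oneC minus unfolding pow by simp
  qed
  also have "\<dots> \<in> sqrt_jacobson R"
    using c aC powC[OF aC] x(1) mC oneC minus(2) by (intro comm2_sqrt_jacobson_m_closed[OF a]) simp_all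
  finally show ?thesis .
qed

end

theorem theorem2p6:
  fixes R (structure) and a
  assumes "ring R" and "a \<in> carrier R"
  shows "(has_generalized_Zhou_inverse R a \<longleftrightarrow>
      (\<exists>p \<in> comm2 R a. p \<otimes> p = p \<and>
        (\<exists>n::nat. n \<ge> 1 \<and> a [^] n \<ominus> p \<in> sqrt_jacobson R)))
    \<and> (has_generalized_Zhou_inverse R a \<longleftrightarrow>
      (\<exists>x \<in> comm2 R a. x = x \<otimes> a \<otimes> x \<and>
        (\<exists>n::nat. n \<ge> 1 \<and> a \<ominus> a [^] (n + 2) \<otimes> x \<in> sqrt_jacobson R)))"
proof -
  interpret ring R by fact
  note a = assms(2)
  have Zhou: "has_generalized_Zhou_inverse R a \<longleftrightarrow>
      (\<exists>b \<in> comm2 R a. b = b \<otimes> a \<otimes> b \<and>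
        (\<exists>n::nat. n \<ge> 1 \<and> a [^] n \<ominus> a \<otimes> b \<in> sqrt_jacobson R))"
    unfolding has_generalized_Zhou_inverse_def comm2_def by blast
  show ?thesis
  proof (intro conjI iffI)
    assume "has_generalized_Zhou_inverse R a"
    then obtain b and n :: nat where b: "b \<in> comm2 R a" "b = b \<otimes> a \<otimes> b"
      and n: "n \<ge> 1" "a [^] n \<ominus> a \<otimes> b \<in> sqrt_jacobson R"
      unfolding Zhou by blast
    show "\<exists>p \<in> comm2 R a. p \<otimes> p = p \<and>
        (\<exists>n::nat. n \<ge> 1 \<and> a [^] n \<ominus> p \<in> sqrt_jacobson R)"
      using reflexive_inverse_idempotent[OF a b] n by blast
    show "\<exists>x \<in> comm2 R a. x = x \<otimes> a \<otimes> x \<and>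
        (\<exists>n::nat. n \<ge> 1 \<and> a \<ominus> a [^] (n + 2) \<otimes> x \<in> sqrt_jacobson R)"
      using defect_in_sqrt_jacobson[OF a b n] b n(1) by blast
  next
    assume "\<exists>p \<in> comm2 R a. p \<otimes> p = p \<and>
        (\<exists>n::nat. n \<ge> 1 \<and> a [^] n \<ominus> p \<in> sqrt_jacobson R)"
    then show "has_generalized_Zhou_inverse R a"
      using idempotent_imp_Zhou[OF a] by blast
  next
    assume "\<exists>x \<in> comm2 R a. x = x \<otimes> a \<otimes> x \<and>
        (\<exists>n::nat. n \<ge> 1 \<and> a \<ominus> a [^] (n + 2) \<otimes> x \<in> sqrt_jacobson R)"
    then show "has_generalized_Zhou_inverse R a"
      unfolding Zhou using power_minus_idempotent_in_sqrt_jacobson[OF a] by blast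
  qed
qed

end
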